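(* Let $d>1$ be a squarefree integer and $F=\mathbb{Q}(\sqrt{-3d})$. Let $M$ and $M_3$ be the ring class fields of the orders $\mathbb{Z}[\sqrt{-3d}]$ and $\mathbb{Z}[\sqrt{-27d}]$ in $F$, respectively, and for a positive integer $N$ let $F_{(N)}$ be the ray class field of $F$ modulo the ideal $(N)$. If $3\nmid d$, then $$\begin{cases} M_3=F_{(6)} & \text{when } d\equiv 1\pmod 4,\\ M_3=F_{(3)} & \text{when } d\equiv 2,3\pmod 4.\end{cases}$$ If $3\mid d$, then $$\begin{cases} M=F_{(6)} & \text{when } d\equiv 1\pmod 4,\\ M=F_{(3)} & \text{when } d\equiv 2,3\pmod 4.\end{cases}$$
   Context: All fields are subfields of $\mathbb{C}$. The ring class field of an order $\mathcal{O}$ of conductor $f$ in an imaginary quadratic field $F$ is the abelian extension of $F$ corresponding, by class field theory, to the group of fractional ideals prime to $f$ modulo the subgroup generated by the principal ideals $\alpha\mathcal{O}_F$ with $\alpha\equiv k \pmod{f\mathcal{O}_F}$ for some integer $k$ coprime to $f$. Its Galois group over $F$ is isomorphic to the class group of $\mathcal{O}$. *)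

theory Defs
  imports
    "HOL-Analysis.Analysis"
    "HOL-Algebra.Algebra"
    "HOL-Algebra.Algebraic_Closure_Type"
    "HOL-Number_Theory.Cong"
begin

text \<open>
  Number fields are subfields of the complex numbers, that is, sets \<open>F\<close> with \<open>subfield F CC\<close>
  for the ring record \<open>CC\<close> of the complex numbers.
\<close>

abbreviation CC :: "complex ring" where
  "CC \<equiv> ring_of_type_algebra"

definition ring_of_integers :: "complex set \<Rightarrow> complex ring" where
  "ring_of_integers F = CC \<lparr>carrier := {x \<in> F. algebraic_int x}\<rparr>"

definition prime_of :: "complex set \<Rightarrow> complex set \<Rightarrow> bool" where
  "prime_of F p \<longleftrightarrow> primeideal p (ring_of_integers F) \<and> p \<noteq> {0}"

definition ideal_norm :: "complex set \<Rightarrow> complex set \<Rightarrow> nat" where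
  "ideal_norm F I = card (carrier (ring_of_integers F Quot I))"


section \<open>Fractional ideals prime to a modulus\<close>

definition fractional_ideal :: "complex set \<Rightarrow> complex set \<Rightarrow> bool" where
  "fractional_ideal F I \<longleftrightarrow>
     additive_subgroup I CC \<and> I \<subseteq> F \<and> I \<noteq> {0} \<and>
     (\<forall>a \<in> carrier (ring_of_integers F). \<forall>x \<in> I. a * x \<in> I) \<and>
     (\<exists>c \<in> carrier (ring_of_integers F). c \<noteq> 0 \<and> (\<forall>x \<in> I. c * x \<in> carrier (ring_of_integers F)))"

definition integral_ideal_prime_to :: "complex set \<Rightarrow> complex set \<Rightarrow> complex set \<Rightarrow> bool" where
  "integral_ideal_prime_to F \<mm> A \<longleftrightarrow>
     ideal A (ring_of_integers F) \<and> A \<noteq> {0} \<and>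
     A <+>\<^bsub>ring_of_integers F\<^esub> \<mm> = carrier (ring_of_integers F)"

text \<open>
  The condition \<open>I B = A\<close> below says that \<open>I = A / B\<close> is a quotient of integral ideals prime
  to \<open>\<mm>\<close>.  The library's \<^const>\<open>ideal_prod\<close> is the set of finite sums of products, so
  it is the product of fractional ideals as well.
\<close>

definition ideal_group :: "complex set \<Rightarrow> complex set \<Rightarrow> complex set monoid" where
  "ideal_group F \<mm> =
     \<lparr>carrier = {I. fractional_ideal F I \<and>
        (\<exists>A B. integral_ideal_prime_to F \<mm> A \<and> integral_ideal_prime_to F \<mm> B \<and>
               ideal_prod CC I B = A)},
      mult = ideal_prod CC,
      one = carrier (ring_of_integers F)\<rparr>"


section \<open>Abelian extensions and the Artin map\<close>

definition Gal :: "complex set \<Rightarrow> complex set \<Rightarrow> (complex \<Rightarrow> complex) monoid" where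
  "Gal L F = (BijGroup L)
     \<lparr>carrier := {\<sigma> \<in> Bij L. \<sigma> \<in> ring_hom (CC\<lparr>carrier := L\<rparr>) (CC\<lparr>carrier := L\<rparr>) \<and>
                            (\<forall>x \<in> F. \<sigma> x = x)}\<rparr>"

definition finite_galois_extension :: "complex set \<Rightarrow> complex set \<Rightarrow> bool" where
  "finite_galois_extension F L \<longleftrightarrow>
     subfield F CC \<and> subfield L CC \<and> F \<subseteq> L \<and> ring.finite_dimension CC F L \<and>
     {x \<in> L. \<forall>\<sigma> \<in> carrier (Gal L F). \<sigma> x = x} = F"

definition finite_abelian_extension :: "complex set \<Rightarrow> complex set \<Rightarrow> bool" where
  "finite_abelian_extension F L \<longleftrightarrow> finite_galois_extension F L \<and> comm_group (Gal L F)"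

text \<open>
  In Dedekind domains, to divide is to contain: \<open>P\<close> lies over \<open>p\<close> iff \<open>p \<subseteq> P\<close>,
  and its ramification index is at least 2 iff \<open>p \<subseteq> P\<^sup>2\<close>.
\<close>

definition unramified_in :: "complex set \<Rightarrow> complex set \<Rightarrow> complex set \<Rightarrow> bool" where
  "unramified_in F L p \<longleftrightarrow>
     (\<forall>P. prime_of L P \<and> p \<subseteq> P \<longrightarrow> \<not> p \<subseteq> ideal_prod CC P P)"

definition is_frobenius ::
    "complex set \<Rightarrow> complex set \<Rightarrow> complex set \<Rightarrow> (complex \<Rightarrow> complex) \<Rightarrow> bool" where
  "is_frobenius F L p \<sigma> \<longleftrightarrow>
     \<sigma> \<in> carrier (Gal L F) \<and>
     (\<forall>P. prime_of L P \<and> p \<subseteq> P \<longrightarrow>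
        (\<forall>x \<in> carrier (ring_of_integers L). \<sigma> x - x ^ ideal_norm F p \<in> P))"

definition is_artin_map ::
    "complex set \<Rightarrow> complex set \<Rightarrow> complex set \<Rightarrow> (complex set \<Rightarrow> complex \<Rightarrow> complex) \<Rightarrow> bool" where
  "is_artin_map F L \<mm> \<phi> \<longleftrightarrow>
     \<phi> \<in> hom (ideal_group F \<mm>) (Gal L F) \<and>
     (\<forall>p. prime_of F p \<and> \<not> \<mm> \<subseteq> p \<longrightarrow> is_frobenius F L p (\<phi> p))"


section \<open>Class fields\<close>

definition is_class_field :: "complex set \<Rightarrow> complex set \<Rightarrow> complex set set \<Rightarrow> complex set \<Rightarrow> bool" where
  "is_class_field F \<mm> H L \<longleftrightarrow>
     finite_abelian_extension F L \<and>
     (\<forall>p. prime_of F p \<and> \<not> \<mm> \<subseteq> p \<longrightarrow> unramified_in F L p) \<and>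
     (\<exists>\<phi>. is_artin_map F L \<mm> \<phi> \<and> kernel (ideal_group F \<mm>) (Gal L F) \<phi> = H)"

text \<open>
  For a number field \<open>F\<close>, a nonzero ideal \<open>\<mm>\<close> and a subgroup \<open>H\<close> of the group of ideals prime
  to \<open>\<mm>\<close> that contains every principal ideal \<open>(\<alpha>)\<close> with \<open>\<alpha> \<equiv> 1\<close> modulo \<open>\<mm>\<close>, the
  existence theorem of class field theory provides exactly one such field.  No archimedean
  part of the modulus is needed, as imaginary quadratic fields have no real places.
\<close>

definition class_field :: "complex set \<Rightarrow> complex set \<Rightarrow> complex set set \<Rightarrow> complex set" where
  "class_field F \<mm> H = (THE L. is_class_field F \<mm> H L)"

definition ray_group :: "complex set \<Rightarrow> complex set \<Rightarrow> complex set set" where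
  "ray_group F \<mm> = generate (ideal_group F \<mm>)
     {PIdl\<^bsub>ring_of_integers F\<^esub> \<alpha> | \<alpha>.
        \<alpha> \<in> carrier (ring_of_integers F) \<and> \<alpha> \<noteq> 0 \<and> \<alpha> - 1 \<in> \<mm>}"

definition ray_class_field :: "complex set \<Rightarrow> complex set \<Rightarrow> complex set" where
  "ray_class_field F \<mm> = class_field F \<mm> (ray_group F \<mm>)"

text \<open>The conductor of an order in a quadratic field is its index in the maximal order.\<close>

definition conductor :: "complex set \<Rightarrow> complex set \<Rightarrow> nat" where
  "conductor F \<O> = card (a_rcosets\<^bsub>ring_of_integers F\<^esub> \<O>)"

definition ring_class_group :: "complex set \<Rightarrow> nat \<Rightarrow> complex set set" where
  "ring_class_group F f =
     generate (ideal_group F (PIdl\<^bsub>ring_of_integers F\<^esub> (of_nat f)))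
       {PIdl\<^bsub>ring_of_integers F\<^esub> \<alpha> | \<alpha> (k :: int).
          \<alpha> \<in> carrier (ring_of_integers F) \<and> \<alpha> \<noteq> 0 \<and> coprime k (int f) \<and>
          \<alpha> - of_int k \<in> PIdl\<^bsub>ring_of_integers F\<^esub> (of_nat f)}"

definition ring_class_field :: "complex set \<Rightarrow> complex set \<Rightarrow> complex set" where
  "ring_class_field F \<O> =
     class_field F (PIdl\<^bsub>ring_of_integers F\<^esub> (of_nat (conductor F \<O>)))
       (ring_class_group F (conductor F \<O>))"

end

theory Submission
  imports Defs
begin

text \<open>
  A class field is determined by its modulus and its ideal group.  Up to the factor \<open>3\<close>, the
  square root in question is \<open>s = \<surd>-m\<close> with \<open>m = 3d\<close> or \<open>m = d/3\<close>
  squarefree, and the order is \<open>\<int>[3s]\<close>.  Its conductor \<open>f\<close> is \<open>6\<close> or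
  \<open>3\<close>, depending on whether \<open>-m \<equiv> 1 (mod 4)\<close>.  In both cases the only units of \<open>\<int>/f\<close>
  are \<open>\<plusminus>1\<close>, so a principal ideal \<open>(\<alpha>)\<close> with \<open>\<alpha> \<equiv> k (mod f)\<close>
  for an integer \<open>k\<close> coprime to \<open>f\<close> is generated by \<open>\<alpha>\<close> or \<open>-\<alpha>\<close>, one of which is
  \<open>1\<close> modulo \<open>f\<close>: the ring class group is the ray class group.
\<close>

section \<open>The ring of complex numbers\<close>

lemma CC_simps [simp]:
  "carrier CC = UNIV" "x \<otimes>\<^bsub>CC\<^esub> y = x * y" "x \<oplus>\<^bsub>CC\<^esub> y = x + y"
  "\<one>\<^bsub>CC\<^esub> = 1" "\<zero>\<^bsub>CC\<^esub> = 0"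
  by (simp_all add: ring_of_type_algebra_def)

lemma CC_a_inv [simp]: "\<ominus>\<^bsub>CC\<^esub> x = - x"
proof -
  interpret field CC by (rule field_from_type_algebra)
  show ?thesis by (rule minus_equality) auto
qed

lemma CC_m_inv [simp]: "x \<noteq> 0 \<Longrightarrow> inv\<^bsub>CC\<^esub> x = inverse x"
proof -
  interpret field CC by (rule field_from_type_algebra)
  show "x \<noteq> 0 \<Longrightarrow> inv\<^bsub>CC\<^esub> x = inverse x" 
    using inv_unique'[of x "inverse x"] by auto
qed

lemma ring_of_integers_simps [simp]:
  "x \<otimes>\<^bsub>ring_of_integers F\<^esub> y = x * y" "x \<oplus>\<^bsub>ring_of_integers F\<^esub> y = x + y"
  by (simp_all add: ring_of_integers_def ring_of_type_algebra_def)

lemma carrier_ring_of_integers: "carrier (ring_of_integers F) = {x \<in> F. algebraic_int x}"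
  by (simp add: ring_of_integers_def)

lemma cgenideal_ring_of_integers:
  "PIdl\<^bsub>ring_of_integers F\<^esub> a = {x * a |x. x \<in> carrier (ring_of_integers F)}"
  by (simp add: cgenideal_def)


section \<open>Quadratic fields and their orders\<close>

text \<open>Because \<open>s * s\<close> is an integer, the integer span of \<open>1\<close> and
  \<open>s\<close> is closed under multiplication, so the induction over
  \<open>generate_ring\<close> never leaves it. This makes orders, and later denominators,
  accessible through coordinates.\<close>

lemma generate_ring_quadratic:
  fixes s :: complex and n :: int
  assumes "s * s = of_int n"
  shows "generate_ring CC {s} = {of_int a + of_int b * s |a b. True}" (is "?A = ?B")
proof
  show "?A \<subseteq> ?B"
  proof
    fix x assume "x \<in> ?A"
    then show "x \<in> ?B"
    proof induction
      case one
      have "\<one>\<^bsub>CC\<^esub> = of_int 1 + of_int 0 * s" by simp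
      then show ?case by blast
    next
      case (incl h)
      then have "h = of_int 0 + of_int 1 * s" by simp
      then show ?case by blast
    next
      case (a_inv h)
      then obtain a b where "h = of_int a + of_int b * s" by auto
      then have "\<ominus>\<^bsub>CC\<^esub> h = of_int (- a) + of_int (- b) * s" by simp
      then show ?case by blast
    next
      case (eng_add h1 h2)
      then obtain a b a' b' where "h1 = of_int a + of_int b * s" "h2 = of_int a' + of_int b' * s"
        by auto
      then have "h1 \<oplus>\<^bsub>CC\<^esub> h2 = of_int (a + a') + of_int (b + b') * s" by (simp add: algebra_simps)
      then show ?case by blast
    next
      case (eng_mult h1 h2)
      then obtain a b a' b' where "h1 = of_int a + of_int b * s" "h2 = of_int a' + of_int b' * s"
        by auto
      then have "h1 \<otimes>\<^bsub>CC\<^esub> h2 = of_int a * of_int a' + of_int b * of_int b' * (s * s)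
          + of_int (a * b' + b * a') * s" 
        by (simp add: algebra_simps)
      also have "\<dots> = of_int (a * a' + b * b' * n) + of_int (a * b' + b * a') * s"
        using assms by simp
      finally show ?case by blast
    qed
  qed
next
  have add: "x + y \<in> ?A" if "x \<in> ?A" "y \<in> ?A" for x y 
    using generate_ring.eng_add[OF that] by simp
  have minus: "- x \<in> ?A" if "x \<in> ?A" for x 
    using generate_ring.a_inv[OF that] by simp
  have mult: "x * y \<in> ?A" if "x \<in> ?A" "y \<in> ?A" for x y 
    using generate_ring.eng_mult[OF that] by simp
  have one: "1 \<in> ?A" 
    using generate_ring.one[of CC] by simp
  have int: "of_int a \<in> ?A" for a
  \<comment> \<open>The generation rules offer one, negatives and sums, but no zero; so the integers
    are reached from 1 in both directions.\<close>
  proof (induction a rule: int_induct[where k = 1])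
    case (step2 i)
    then show ?case using add[OF step2(2) minus[OF one]] by simp
  qed (use one add in auto)
  have "s \<in> ?A" by (simp add: generate_ring.incl)
  then show "?B \<subseteq> ?A"
    using int add mult by auto
qed

text \<open>The rational span of \<open>1\<close> and \<open>s\<close> is closed under inverses:
  multiply by the conjugate and divide by the norm. The factor \<open>c\<close> allows the generator
  to be a multiple of the root of the squarefree number, as happens when 3 divides
  \<open>d\<close>.\<close>

lemma generate_field_quadratic:
  fixes s :: complex and n c :: int
  assumes "s * s = of_int n" "s \<notin> \<rat>" "c \<noteq> 0"
  shows "generate_field CC {of_int c * s} = {of_rat a + of_rat b * s |a b. True}" (is "?A = ?B")
proof
  show "?A \<subseteq> ?B"
  proof
    fix x assume "x \<in> ?A"
    then show "x \<in> ?B"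
    proof induction
      case one
      have "\<one>\<^bsub>CC\<^esub> = of_rat 1 + of_rat 0 * s" by simp
      then show ?case by blast
    next
      case (incl h)
      then have "h = of_rat 0 + of_rat (of_int c) * s" by simp
      then show ?case by blast
    next
      case (a_inv h)
      then obtain a b where "h = of_rat a + of_rat b * s" by auto
      then have "\<ominus>\<^bsub>CC\<^esub> h = of_rat (- a) + of_rat (- b) * s" by (simp add: of_rat_minus)
      then show ?case by blast
    next
      case (m_inv h)
      then obtain a b where h: "h = of_rat a + of_rat b * s" by auto
      \<comment> \<open>The norm of \<open>h\<close>, that is, the product of \<open>h\<close> and
        its conjugate \<open>of_rat a - of_rat b * s\<close>.\<close>
      define N where "N = a * a - b * b * of_int n"
      have h': "h * (of_rat a - of_rat b * s) = of_rat N"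
      proof -
        have "h * (of_rat a - of_rat b * s) = of_rat a * of_rat a - of_rat b * of_rat b * (s * s)"
          by (simp add: h algebra_simps)
        then show ?thesis using assms(1) by (simp add: N_def of_rat_diff of_rat_mult)
      qed
      \<comment> \<open>A vanishing conjugate would make \<open>h\<close> zero (if
        \<open>b = 0\<close>) or \<open>s\<close> rational.\<close>
      have "of_rat a - of_rat b * s \<noteq> 0"
      proof
        assume *: "of_rat a - of_rat b * s = 0"
        show False
        proof (cases "b = 0")
          case True
          then show False using * m_inv h by simp
        next
          case False
          then have "s = of_rat (a / b)" using * by (simp add: of_rat_divide field_simps)
          then show False using assms(2) by auto
        qed
      qed
      with h' m_inv have N: "N \<noteq> 0" by auto
      have "inverse h * of_rat N = of_rat a - of_rat b * s"
        using m_inv(2) by (simp flip: h' mult.assoc)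
      then have "inverse h = (of_rat a - of_rat b * s) / of_rat N"
        using N by (simp add: eq_divide_eq)
      also have "\<dots> = of_rat (a / N) + of_rat (- b / N) * s"
        by (simp add: of_rat_divide of_rat_minus diff_divide_distrib)
      finally show ?case using m_inv by auto
    next
      case (eng_add h1 h2)
      then obtain a b a' b' where "h1 = of_rat a + of_rat b * s" "h2 = of_rat a' + of_rat b' * s"
        by auto
      then have "h1 \<oplus>\<^bsub>CC\<^esub> h2 = of_rat (a + a') + of_rat (b + b') * s" 
        by (simp add: algebra_simps of_rat_add)
      then show ?case by blast
    next
      case (eng_mult h1 h2)
      then obtain a b a' b' where "h1 = of_rat a + of_rat b * s" "h2 = of_rat a' + of_rat b' * s"
        by auto
      then have "h1 \<otimes>\<^bsub>CC\<^esub> h2 = of_rat a * of_rat a' + of_rat b * of_rat b' * (s * s)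
          + of_rat (a * b' + b * a') * s" 
        by (simp add: algebra_simps of_rat_add of_rat_mult)
      also have "\<dots> = of_rat (a * a' + b * b' * of_int n) + of_rat (a * b' + b * a') * s"
        using assms by (simp add: of_rat_add of_rat_mult)
      finally show ?case by blast
    qed
  qed
next
  have add: "x + y \<in> ?A" if "x \<in> ?A" "y \<in> ?A" for x y 
    using generate_field.eng_add[OF that] by simp
  have minus: "- x \<in> ?A" if "x \<in> ?A" for x 
    using generate_field.a_inv[OF that] by simp
  have mult: "x * y \<in> ?A" if "x \<in> ?A" "y \<in> ?A" for x y 
    using generate_field.eng_mult[OF that] by simp
  have inverse: "inverse x \<in> ?A" if "x \<in> ?A" "x \<noteq> 0" for x
    using generate_field.m_inv[OF that(1)] that(2) by simp
  have one: "1 \<in> ?A" 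
    using generate_field.one[of CC] by simp
  have int: "of_int a \<in> ?A" for a
  proof (induction a rule: int_induct[where k = 1])
    case (step2 i)
    then show ?case using add[OF step2(2) minus[OF one]] by simp
  qed (use one add in auto)
  have rat: "of_rat a \<in> ?A" for a
  proof (cases a)
    case (Fract p q)
    then have "(of_rat a :: complex) = of_int p * inverse (of_int q)"
      by (simp add: of_rat_rat field_simps)
    then show ?thesis using mult[OF int inverse[OF int, of q]] Fract by simp
  qed
  \<comment> \<open>Dividing the generator by \<open>c\<close> recovers \<open>s\<close>
    itself.\<close>
  have "inverse (of_int c) \<in> ?A" using inverse[OF int, of c] assms(3) by simp
  moreover have "of_int c * s \<in> ?A" by (simp add: generate_field.incl)
  ultimately have "inverse (of_int c) * (of_int c * s) \<in> ?A" by (rule mult)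
  then have "s \<in> ?A" using assms(3) by (simp flip: mult.assoc)
  then show "?B \<subseteq> ?A"
    using rat add mult by auto
qed


section \<open>Integrality in a quadratic field\<close>

lemma rat_quotient_cases:
  fixes r :: rat
  obtains p q :: int where "r = of_int p / of_int q" "q > 0" "coprime p q"
  by (cases r) (auto simp: Fract_of_int_quotient)

text \<open>If \<open>t\<close> has denominator \<open>q\<close> in lowest terms, then
  \<open>q ^ k\<close> divides the fixed nonzero \<open>D\<close> for every \<open>k\<close>, which
  is impossible for \<open>q \<ge> 2\<close>.\<close>

lemma int_if_powers_bounded_denominator:
  fixes t :: rat and D :: int
  assumes "D \<noteq> 0" and "\<And>k. of_int D * t ^ k \<in> \<int>"
  shows "t \<in> \<int>"
proof -
  obtain p q where t: "t = of_int p / of_int q" and q: "q > 0" and cop: "coprime p q"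
    by (rule rat_quotient_cases)
  have "q ^ k dvd D" for k
  proof -
    obtain z where "of_int D * t ^ k = of_int z" using assms(2) Ints_cases by blast
    then have "(of_int (D * p ^ k) :: rat) = of_int (z * q ^ k)"
      using q by (simp add: t power_divide field_simps)
    then have "D * p ^ k = z * q ^ k" by (simp only: of_int_eq_iff)
    then have "q ^ k dvd D * p ^ k" by simp
    moreover have "coprime (q ^ k) (p ^ k)" using cop by (simp add: coprime_commute)
    ultimately show ?thesis by (simp add: coprime_dvd_mult_left_iff)
  qed
  then have le: "q ^ k \<le> \<bar>D\<bar>" for k
    using dvd_imp_le_int[OF assms(1), of "q ^ k"] q by simp
  have "q = 1"
  proof (rule ccontr)
    assume "q \<noteq> 1"
    \<comment> \<open>The exponent \<open>\<bar>D\<bar>\<close> is large enough, since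
      \<open>2 ^ n > n\<close>.\<close>
    then have "2 ^ nat \<bar>D\<bar> \<le> q ^ nat \<bar>D\<bar>" using q by (intro power_mono) auto
    moreover have "int (nat \<bar>D\<bar>) < 2 ^ nat \<bar>D\<bar>" by (rule of_nat_less_two_power)
    ultimately show False using le[of "nat \<bar>D\<bar>"] by linarith
  qed
  then show ?thesis using t by simp
qed

text \<open>The square of the denominator of \<open>b\<close> is coprime to the square of the
  numerator, so it must divide the squarefree \<open>m\<close>.\<close>

lemma int_if_squarefree_mult_square_int:
  fixes b :: rat and m :: int
  assumes "squarefree m" and "of_int m * b\<^sup>2 \<in> \<int>"
  shows "b \<in> \<int>"
proof -
  obtain p q where b: "b = of_int p / of_int q" and q: "q > 0" and cop: "coprime p q"
    by (rule rat_quotient_cases)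
  obtain z where "of_int m * b\<^sup>2 = of_int z" using assms(2) Ints_cases by blast
  then have "(of_int (m * p\<^sup>2) :: rat) = of_int (z * q\<^sup>2)"
    using q by (simp add: b power_divide field_simps)
  then have "m * p\<^sup>2 = z * q\<^sup>2" by (simp only: of_int_eq_iff)
  then have "q\<^sup>2 dvd m * p\<^sup>2" by simp
  moreover have "coprime (q\<^sup>2) (p\<^sup>2)" using cop by (simp add: coprime_commute)
  ultimately have "q\<^sup>2 dvd m" by (simp add: coprime_dvd_mult_left_iff)
  then have "q dvd 1" using assms(1) squarefreeD by blast
  then show ?thesis using b q by simp
qed

text \<open>
  All powers of an algebraic integer \<open>x\<close> of \<open>\<rat>(s)\<close> lie in the span of finitely many of them,
  hence have a common denominator.
\<close>

lemma algebraic_int_powers_common_denominator: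
  fixes s x :: complex and n :: int
  assumes "s * s = of_int n" "algebraic_int x" "x = of_rat a + of_rat b * s"
  obtains D :: int where "D \<noteq> 0" "\<And>k. of_int D * x ^ k \<in> generate_ring CC {s}"
proof -
  let ?Z = "generate_ring CC {s}"
  note Z = generate_ring_quadratic[OF assms(1)]
  have add: "x + y \<in> ?Z" if "x \<in> ?Z" "y \<in> ?Z" for x y 
    using generate_ring.eng_add[OF that] by simp
  have mult: "x * y \<in> ?Z" if "x \<in> ?Z" "y \<in> ?Z" for x y 
    using generate_ring.eng_mult[OF that] by simp
  have int: "of_int a \<in> ?Z" for a
  proof -
    have "of_int a = of_int a + of_int 0 * s" by simp
    then show ?thesis unfolding Z by blast
  qed
  have sum: "(\<Sum>i\<in>I. f i) \<in> ?Z" if "\<And>i. i \<in> I \<Longrightarrow> f i \<in> ?Z" for f and I :: "nat set"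
    using that int[of 0] by (induction I rule: infinite_finite_induct) (auto intro: add)
  have power: "y ^ k \<in> ?Z" if "y \<in> ?Z" for y k
    using that int[of 1] by (induction k) (auto intro: mult)
  obtain p where p: "Polynomial.lead_coeff p = 1" "\<And>i. Polynomial.coeff p i \<in> \<int>" "poly p x = 0"
    using assms(2) by (auto elim!: algebraic_int.cases)
  define d where "d = Polynomial.degree p"
  obtain a1 a2 where a: "a = of_int a1 / of_int a2" "a2 > 0" "coprime a1 a2"
    by (rule rat_quotient_cases)
  obtain b1 b2 where b: "b = of_int b1 / of_int b2" "b2 > 0" "coprime b1 b2"
    by (rule rat_quotient_cases)
  \<comment> \<open>A common denominator of \<open>a\<close> and \<open>b\<close>: it moves
    \<open>x\<close> into \<int>[s].\<close>
  define c where "c = a2 * b2"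
  have c: "c \<noteq> 0" using a b by (simp add: c_def)
  have "of_int c * x = of_int (a1 * b2) + of_int (b1 * a2) * s"
    using a(2) b(2) by (simp add: assms(3) a(1) b(1) c_def of_rat_divide field_simps)
  then have cx: "of_int c * x \<in> ?Z" unfolding Z by blast
  \<comment> \<open>One denominator serves all powers. Below the degree \<open>d\<close> it contains
    the factor \<open>c ^ k\<close> that \<open>x ^ k\<close> needs; from \<open>d\<close> on, the
    monic equation lowers the exponent.\<close>
  have "of_int (c ^ d) * x ^ k \<in> ?Z" for k
  proof (induction k rule: less_induct)
    case (less k)
    show ?case
    proof (cases "k < d")
      case True
      have "of_int (c ^ d) * x ^ k = of_int (c ^ (d - k)) * (of_int c * x) ^ k"
        using True by (simp add: power_mult_distrib flip: power_add mult.assoc)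
      then show ?thesis using mult[OF int power[OF cx]] by metis
    next
      case False
      have "poly p x = (\<Sum>i<d. Polynomial.coeff p i * x ^ i) + x ^ d"
        using p(1) by (simp add: poly_altdef d_def lessThan_Suc_atMost[symmetric])
      then have xd: "x ^ d = - (\<Sum>i<d. Polynomial.coeff p i * x ^ i)" 
        using p(3) by (simp add: eq_neg_iff_add_eq_0 add.commute)
      have "of_int (c ^ d) * x ^ k = of_int (c ^ d) * (x ^ (k - d) * x ^ d)"
        using False by (simp flip: power_add)
      also have "\<dots> = (\<Sum>i<d. - Polynomial.coeff p i * (of_int (c ^ d) * x ^ (k - d + i)))"
        unfolding xd by (simp add: sum_distrib_left sum_negf power_add mult_ac)
      also have "\<dots> \<in> ?Z"
      proof (rule sum)
        fix i assume i: "i \<in> {..<d}"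
        obtain z where z: "Polynomial.coeff p i = of_int z" using p(2) Ints_cases by blast
        \<comment> \<open>As \<open>i < d\<close>, the exponent \<open>k - d + i\<close> is below
          \<open>k\<close>, so the induction hypothesis applies.\<close>
        have "of_int (- z) * (of_int (c ^ d) * x ^ (k - d + i)) \<in> ?Z"
          using i False by (intro mult int less) auto
        then show "- Polynomial.coeff p i * (of_int (c ^ d) * x ^ (k - d + i)) \<in> ?Z" by (simp add: z)
      qed
      finally show ?thesis .
    qed
  qed
  with that[of "c ^ d"] c show thesis by simp
qed

lemma Im_of_rat: "Im (of_rat r) = 0"
  by (cases r) (simp add: of_rat_rat complex_is_Real_iff[symmetric])

text \<open>
  For algebraic integers \<open>x\<close> and \<open>cnj x\<close> of \<open>\<rat>(s)\<close>, also all powers of \<open>x + cnj x\<close> and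
  \<open>x * cnj x\<close> have a common denominator, so these two rational numbers are integers.
\<close>

lemma quadratic_integer_trace_norm:
  fixes s x :: complex and m :: int
  assumes s: "s * s = - of_int m" "cnj s = - s"
    and x: "algebraic_int x" "x = of_rat a + of_rat b * s"
  shows "2 * a \<in> \<int>" "a\<^sup>2 + of_int m * b\<^sup>2 \<in> \<int>"
proof -
  let ?Z = "generate_ring CC {s}"
  have s': "s * s = of_int (- m)" using s by simp
  note Z = generate_ring_quadratic[OF s']
  have add: "x + y \<in> ?Z" if "x \<in> ?Z" "y \<in> ?Z" for x y 
    using generate_ring.eng_add[OF that] by simp
  have mult: "x * y \<in> ?Z" if "x \<in> ?Z" "y \<in> ?Z" for x y 
    using generate_ring.eng_mult[OF that] by simp
  have int: "of_int a \<in> ?Z" for a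
  proof -
    have "of_int a = of_int a + of_int 0 * s" by simp
    then show ?thesis unfolding Z by blast
  qed
  have sum: "(\<Sum>i\<in>I. f i) \<in> ?Z" if "\<And>i. i \<in> I \<Longrightarrow> f i \<in> ?Z" for f and I :: "nat set"
    using that int[of 0] by (induction I rule: infinite_finite_induct) (auto intro: add)
  obtain D where D: "D \<noteq> 0" "\<And>k. of_int D * x ^ k \<in> ?Z"
    using algebraic_int_powers_common_denominator[OF s' x] by blast
  have cnj_rat: "cnj (of_rat r) = of_rat r" for r
    by (simp add: complex_eq_iff Im_of_rat)
  \<comment> \<open>Conjugation maps \<int>[s] to itself, because it negates \<open>s\<close>; so
    the same \<open>D\<close> works for the conjugate.\<close>
  have Dc: "of_int D * cnj x ^ k \<in> ?Z" for k
  proof -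
    obtain p q where "of_int D * x ^ k = of_int p + of_int q * s" using D(2)[of k] unfolding Z by auto
    then have "cnj (of_int D * x ^ k) = cnj (of_int p + of_int q * s)" by simp
    then have "of_int D * cnj x ^ k = of_int p + of_int (- q) * s" by (simp add: s)
    then show ?thesis unfolding Z by blast
  qed
  \<comment> \<open>A rational element of \<int>[s] equals its conjugate, so its
    \<open>s\<close>-part vanishes and an integer remains.\<close>
  have rat: "r \<in> \<int>" if r: "of_rat r \<in> ?Z" for r :: rat
  proof -
    obtain p q where pq: "of_rat r = of_int p + of_int q * s" using r unfolding Z by auto
    then have "cnj (of_rat r) = cnj (of_int p + of_int q * s)" by simp
    then have "of_rat r = of_int p - of_int q * s" by (simp add: s cnj_rat)
    then have "of_int q * s = 0" using pq by (simp add: complex_eq_iff)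
    then have "of_rat r = (of_rat (of_int p) :: complex)" using pq by simp
    then show ?thesis by (simp only: of_rat_eq_iff) simp
  qed
  have cx: "cnj x = of_rat a - of_rat b * s" by (simp add: x(2) s cnj_rat)
  have tr: "x + cnj x = of_rat (2 * a)" unfolding cx unfolding x(2) by (simp add: of_rat_mult)
  have "x * cnj x = of_rat a * of_rat a - of_rat b * of_rat b * (s * s)"
    unfolding cx unfolding x(2) by (simp add: algebra_simps)
  then have no: "x * cnj x = of_rat (a\<^sup>2 + of_int m * b\<^sup>2)"
    using s(1) by (simp add: of_rat_add of_rat_mult power2_eq_square)
  \<comment> \<open>Every term below is a product of a power of \<open>x\<close> and a power of
    \<open>cnj x\<close>, each of which takes one factor \<open>D\<close>.\<close>
  have DD: "D * D \<noteq> 0" using D(1) by simp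
  have "of_int (D * D) * (2 * a) ^ k \<in> \<int>" for k
  proof (rule rat)
    have "of_rat (of_int (D * D) * (2 * a) ^ k) = of_int (D * D) * (x + cnj x) ^ k"
      unfolding tr by (simp add: of_rat_mult of_rat_power)
    also have "\<dots> = (\<Sum>i\<le>k. of_int (int (k choose i)) * ((of_int D * x ^ i) * (of_int D * cnj x ^ (k - i))))"
      by (simp add: binomial_ring sum_distrib_left mult_ac)
    also have "\<dots> \<in> ?Z" by (intro sum mult int D Dc)
    finally show "of_rat (of_int (D * D) * (2 * a) ^ k) \<in> ?Z" .
  qed
  then show "2 * a \<in> \<int>" by (rule int_if_powers_bounded_denominator[OF DD])
  have "of_int (D * D) * (a\<^sup>2 + of_int m * b\<^sup>2) ^ k \<in> \<int>" for k
  proof (rule rat)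
    have "of_rat (of_int (D * D) * (a\<^sup>2 + of_int m * b\<^sup>2) ^ k) = of_int (D * D) * (x * cnj x) ^ k"
      unfolding no by (simp add: of_rat_mult of_rat_power)
    also have "\<dots> = (of_int D * x ^ k) * (of_int D * cnj x ^ k)"
      by (simp add: power_mult_distrib mult_ac)
    also have "\<dots> \<in> ?Z" by (intro mult D Dc)
    finally show "of_rat (of_int (D * D) * (a\<^sup>2 + of_int m * b\<^sup>2) ^ k) \<in> ?Z" .
  qed
  then show "a\<^sup>2 + of_int m * b\<^sup>2 \<in> \<int>" 
    by (rule int_if_powers_bounded_denominator[OF DD])
qed

text \<open>The trace is the integer \<open>u = 2 * a\<close>. Four times the norm shows that
  \<open>m * (2 * b)\<^sup>2\<close> is an integer, so \<open>v = 2 * b\<close> is one too, as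
  \<open>m\<close> is squarefree. The divisibility by 4 is the integrality of the norm.\<close>

lemma quadratic_integer_halves:
  fixes s x :: complex and m :: int
  assumes s: "s * s = - of_int m" "cnj s = - s" and m: "squarefree m"
    and x: "algebraic_int x" "x = of_rat a + of_rat b * s"
  obtains u v :: int where "x = (of_int u + of_int v * s) / 2" "4 dvd u\<^sup>2 + m * v\<^sup>2"
proof -
  note tn = quadratic_integer_trace_norm[OF s x]
  obtain u where u: "2 * a = of_int u" using tn(1) Ints_cases by blast
  obtain n where n: "a\<^sup>2 + of_int m * b\<^sup>2 = of_int n" using tn(2) Ints_cases by blast
  have eq: "of_int m * (2 * b)\<^sup>2 = of_int (4 * n - u\<^sup>2)"
    using n by (simp flip: u add: power_mult_distrib algebra_simps)
  have "of_int m * (2 * b)\<^sup>2 \<in> \<int>" by (simp only: eq Ints_of_int)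
  with m have "2 * b \<in> \<int>" by (rule int_if_squarefree_mult_square_int)
  then obtain v where v: "2 * b = of_int v" using Ints_cases by blast
  have "(of_int (m * v\<^sup>2) :: rat) = of_int (4 * n - u\<^sup>2)" using eq by (simp add: v)
  then have "m * v\<^sup>2 = 4 * n - u\<^sup>2" by (simp only: of_int_eq_iff)
  then have "u\<^sup>2 + m * v\<^sup>2 = 4 * n" by simp
  then have dvd: "4 dvd u\<^sup>2 + m * v\<^sup>2" by simp
  have "a = of_int u / 2" "b = of_int v / 2" using u v by simp_all
  then have "x = (of_int u + of_int v * s) / 2" 
    unfolding x(2) by (simp only:) (simp add: of_rat_divide add_divide_distrib)
  with dvd that show thesis by blast
qed

section \<open>Integral bases of the maximal order\<close>

lemma algebraic_int_quadratic:
  fixes x :: complex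
  assumes "x * x = of_int t * x + of_int n"
  shows "algebraic_int x"
proof (rule algebraic_int.intros[of "[:- of_int n, - of_int t, 1:]"])
  show "\<forall>i. Polynomial.coeff [:- of_int n, - of_int t, 1:] i \<in> (\<int> :: complex set)"
    by (auto simp: coeff_pCons split: nat.splits)
qed (use assms in \<open>auto simp: algebra_simps\<close>)

text \<open>The case \<open>-m \<equiv> 1\<close> modulo 4. As \<open>m\<close> is odd, integrality
  of the norm forces \<open>u\<close> and \<open>v\<close> to have the same parity, which gives
  coordinates with respect to \<open>(1 + s) / 2\<close>.\<close>

lemma ring_of_integers_quadratic_1:
  fixes s :: complex and m :: int
  assumes s: "s * s = - of_int m" "cnj s = - s" and m: "squarefree m" "m mod 4 = 3"
    and F: "F = {of_rat a + of_rat b * s |a b. True}"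
  shows "carrier (ring_of_integers F) = {of_int a + of_int b * ((1 + s) / 2) |a b. True}"
proof (intro equalityI subsetI)
  fix x assume "x \<in> carrier (ring_of_integers F)"
  then obtain a b where "algebraic_int x" "x = of_rat a + of_rat b * s"
    by (auto simp: carrier_ring_of_integers F)
  then obtain u v where x: "x = (of_int u + of_int v * s) / 2" and uv: "4 dvd u\<^sup>2 + m * v\<^sup>2"
    using quadratic_integer_halves[OF s m(1)] by metis
  have "even (u\<^sup>2 + m * v\<^sup>2)" using uv by (metis dvd_trans even_numeral)
  moreover have "odd m" using m(2) by presburger
  ultimately have "even (u - v)" by simp
  then obtain j where j: "u - v = 2 * j" by (rule evenE)
  have "x = of_int j + of_int v * ((1 + s) / 2)"
  proof -
    have "u = v + 2 * j" using j by simp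
    then show ?thesis by (simp add: x field_simps)
  qed
  then show "x \<in> {of_int a + of_int b * ((1 + s) / 2) |a b. True}" by blast
next
  fix x assume "x \<in> {of_int a + of_int b * ((1 + s) / 2) |a b. True}"
  then obtain a b where x: "x = of_int a + of_int b * ((1 + s) / 2)" by auto
  have "x = of_rat (of_int a + of_int b / 2) + of_rat (of_int b / 2) * s"
    by (simp add: x of_rat_add of_rat_divide add_divide_distrib distrib_left)
  then have "x \<in> F" unfolding F by blast
  \<comment> \<open>The norm of \<open>w = (1 + s) / 2\<close>, whose trace is 1; the division is
    exact as \<open>m mod 4 = 3\<close>.\<close>
  define k where "k = (m + 1) div 4"
  have "4 * k = m + 1" using m(2) unfolding k_def by presburger
  then have "m = 4 * k - 1" by simp
  then have s': "s * s = 1 - 4 * of_int k" using s(1) by simp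
  define w where "w = (1 + s) / 2"
  have s2: "s = 2 * w - 1" by (simp add: w_def)
  have "4 * (w * w) = s * s + 4 * w - 1" unfolding s2 by (simp add: algebra_simps)
  then have "4 * (w * w) = 4 * (w - of_int k)" unfolding s' by (simp add: algebra_simps)
  then have w: "w * w = w - of_int k" by (simp only: mult_cancel_left) simp
  have "x * x = of_int a * of_int a + 2 * of_int a * of_int b * w + of_int b * of_int b * (w * w)"
    by (simp add: x algebra_simps flip: w_def)
  \<comment> \<open>The coefficients are the trace of \<open>x\<close> and the negative of its
    norm.\<close>
  also have "\<dots> = of_int (2 * a + b) * x + of_int (- a * a - a * b - b * b * k)"
    unfolding w by (simp add: x algebra_simps flip: w_def)
  finally have "algebraic_int x" by (rule algebraic_int_quadratic)
  with \<open>x \<in> F\<close> show "x \<in> carrier (ring_of_integers F)"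
    by (simp add: carrier_ring_of_integers)
qed

text \<open>Squares are 0 or 1 modulo 4, so for these \<open>m\<close> the sum
  \<open>u\<^sup>2 + m * v\<^sup>2\<close> is divisible by 4 only if \<open>u\<close> and
  \<open>v\<close> are both even; the halves then cancel.\<close>

lemma ring_of_integers_quadratic_2_3:
  fixes s :: complex and m :: int
  assumes s: "s * s = - of_int m" "cnj s = - s" 
    and m: "squarefree m" "m mod 4 = 1 \<or> m mod 4 = 2"
    and F: "F = {of_rat a + of_rat b * s |a b. True}"
  shows "carrier (ring_of_integers F) = {of_int a + of_int b * s |a b. True}"
proof (intro equalityI subsetI)
  fix x assume "x \<in> carrier (ring_of_integers F)"
  then obtain a b where "algebraic_int x" "x = of_rat a + of_rat b * s"
    by (auto simp: carrier_ring_of_integers F)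
  then obtain u v where x: "x = (of_int u + of_int v * s) / 2" and uv: "4 dvd u\<^sup>2 + m * v\<^sup>2"
    using quadratic_integer_halves[OF s m(1)] by metis
  have sq: "y\<^sup>2 mod 4 = (if even y then 0 else 1)" for y :: int
  proof (cases "even y")
    case True
    then show ?thesis by (auto elim!: evenE simp: power_mult_distrib)
  next
    case False
    then obtain z where "y = 2 * z + 1" by (rule oddE)
    then have "y\<^sup>2 = 1 + 4 * (z * z + z)" by (simp add: power2_eq_square algebra_simps)
    then obtain n where "y\<^sup>2 = 1 + 4 * n" by blast
    then show ?thesis using False by simp
  qed
  have "(u\<^sup>2 mod 4 + (m mod 4) * (v\<^sup>2 mod 4) mod 4) mod 4 = (u\<^sup>2 + m * v\<^sup>2) mod 4"
    by (simp only: mod_add_eq mod_mult_eq)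
  also have "\<dots> = 0" using uv by simp
  finally have "(u\<^sup>2 mod 4 + (m mod 4) * (v\<^sup>2 mod 4) mod 4) mod 4 = 0" .
  then have "even u \<and> even v" 
    using m(2) unfolding sq by (cases "even u"; cases "even v") auto
  then obtain u' v' where "u = 2 * u'" "v = 2 * v'" by blast
  then have "x = of_int u' + of_int v' * s" by (simp add: x)
  then show "x \<in> {of_int a + of_int b * s |a b. True}" by blast
next
  fix x assume "x \<in> {of_int a + of_int b * s |a b. True}"
  then obtain a b where x: "x = of_int a + of_int b * s" by auto
  have "x = of_rat (of_int a) + of_rat (of_int b) * s" by (simp add: x)
  then have "x \<in> F" unfolding F by blast
  have "x * x = of_int a * of_int a + 2 * of_int a * of_int b * s + of_int b * of_int b * (s * s)"
    by (simp add: x algebra_simps)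
  also have "\<dots> = of_int (2 * a) * x + of_int (- a * a - b * b * m)"
    unfolding s by (simp add: x algebra_simps)
  finally have "algebraic_int x" by (rule algebraic_int_quadratic)
  with \<open>x \<in> F\<close> show "x \<in> carrier (ring_of_integers F)"
    by (simp add: carrier_ring_of_integers)
qed


section \<open>Conductors and ideal groups\<close>

lemma int_combination_eq_iff:
  fixes w :: complex
  assumes "Im w \<noteq> 0"
  shows "of_int a + of_int b * w = of_int a' + of_int b' * w \<longleftrightarrow> a = a' \<and> b = b'"
  using assms by (auto simp: complex_eq_iff)

text \<open>The coset of \<open>c + k * w\<close> consists of all elements whose
  \<open>w\<close>-coordinate is congruent to \<open>k\<close> modulo \<open>N\<close>. This is the
  set \<open>C k\<close>, so the residues modulo \<open>N\<close> enumerate the cosets.\<close>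

lemma conductor_eqI:
  fixes w :: complex and N :: nat
  assumes w: "Im w \<noteq> 0" and N: "N > 0"
    and R: "carrier (ring_of_integers F) = {of_int a + of_int b * w |a b. True}"
    and H: "H = {of_int a + of_int (int N * b) * w |a b. True}"
  shows "conductor F H = N"
proof -
  let ?R = "ring_of_integers F"
  define C where "C k = {of_int a + of_int b * w |a b. b mod int N = k mod int N}" for k :: int
  have coset: "H +>\<^bsub>?R\<^esub> (of_int c + of_int k * w) = C k" for c k
  proof (intro equalityI subsetI)
    fix x assume "x \<in> H +>\<^bsub>?R\<^esub> (of_int c + of_int k * w)"
    then obtain a b where "x = of_int a + of_int (int N * b) * w + (of_int c + of_int k * w)"
      by (auto simp: a_r_coset_def' H)
    then have "x = of_int (a + c) + of_int (int N * b + k) * w" by (simp add: algebra_simps)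
    moreover have "(int N * b + k) mod int N = k mod int N" by simp
    ultimately show "x \<in> C k" unfolding C_def by blast
  next
    fix x assume "x \<in> C k"
    then obtain a b where x: "x = of_int a + of_int b * w" and "b mod int N = k mod int N"
      unfolding C_def by auto
    then have "int N dvd b - k" by (simp add: mod_eq_dvd_iff)
    then obtain j where "b - k = int N * j" by (rule dvdE)
    then have "b = k + int N * j" by simp
    then have "x = (of_int (a - c) + of_int (int N * j) * w) + (of_int c + of_int k * w)"
      by (simp add: x algebra_simps)
    moreover have "of_int (a - c) + of_int (int N * j) * w \<in> H"
      unfolding H by blast
    ultimately show "x \<in> H +>\<^bsub>?R\<^esub> (of_int c + of_int k * w)"
      unfolding a_r_coset_def' ring_of_integers_simps by blast
  qed
  have "a_rcosets\<^bsub>?R\<^esub> H = C ` UNIV"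
  proof (intro equalityI subsetI)
    fix Y assume "Y \<in> a_rcosets\<^bsub>?R\<^esub> H"
    then obtain c k where "Y = H +>\<^bsub>?R\<^esub> (of_int c + of_int k * w)"
      unfolding A_RCOSETS_def' R by blast
    then show "Y \<in> C ` UNIV" unfolding coset by blast
  next
    fix Y assume "Y \<in> C ` UNIV"
    then obtain k where "Y = H +>\<^bsub>?R\<^esub> (of_int 0 + of_int k * w)"
      unfolding coset by blast
    then show "Y \<in> a_rcosets\<^bsub>?R\<^esub> H"
      unfolding A_RCOSETS_def' R by blast
  qed
  also have "\<dots> = C ` {0..<int N}"
  proof (intro equalityI subsetI)
    fix Y assume "Y \<in> C ` UNIV"
    then obtain k where "Y = C k" by auto
    then have "Y = C (k mod int N)" by (simp add: C_def)
    then show "Y \<in> C ` {0..<int N}" using N by auto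
  qed auto
  finally have eq: "a_rcosets\<^bsub>?R\<^esub> H = C ` {0..<int N}" .
  have "inj_on C {0..<int N}"
  proof (rule inj_onI)
    fix j k assume jk: "j \<in> {0..<int N}" "k \<in> {0..<int N}" "C j = C k"
    \<comment> \<open>This element lies in \<open>C k\<close> as well; by uniqueness of coordinates
      \<open>j\<close> and \<open>k\<close> agree modulo \<open>N\<close>, hence are equal in the
      given range.\<close>
    have "of_int 0 + of_int j * w \<in> C j" unfolding C_def by blast
    then obtain a b where ab: "of_int 0 + of_int j * w = of_int a + of_int b * w"
        "b mod int N = k mod int N"
      unfolding jk(3) unfolding C_def by blast
    have "j = b" using ab(1) unfolding int_combination_eq_iff[OF w] by simp
    then show "j = k" using jk(1,2) ab(2) by simp
  qed
  then show ?thesis by (simp add: conductor_def eq card_image)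
qed

text \<open>The two generating sets already coincide: \<open>\<alpha>\<close> and
  \<open>- \<alpha>\<close> generate the same ideal, and when \<open>k\<close> is 1 or -1 modulo
  \<open>f\<close>, one of them is 1 modulo \<open>f\<close>. The integral basis supplies closure
  under negation and under adding integers.\<close>

lemma ring_class_group_eq_ray_group:
  fixes w :: complex and f :: nat
  assumes R: "carrier (ring_of_integers F) = {of_int a + of_int b * w |a b. True}"
    and f: "\<And>k. coprime k (int f) \<Longrightarrow> [k = 1] (mod int f) \<or> [k = - 1] (mod int f)"
  shows "ring_class_group F f = ray_group F (PIdl\<^bsub>ring_of_integers F\<^esub> (of_nat f))"
proof -
  let ?R = "ring_of_integers F" and ?f = "PIdl\<^bsub>ring_of_integers F\<^esub> (of_nat f)"
  have minus: "- x \<in> carrier ?R" if x: "x \<in> carrier ?R" for x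
  proof -
    obtain a b where "x = of_int a + of_int b * w" using x unfolding R by auto
    then have "- x = of_int (- a) + of_int (- b) * w" by simp
    then show ?thesis unfolding R by blast
  qed
  have plus_int: "x + of_int j \<in> carrier ?R" if x: "x \<in> carrier ?R" for x j
  proof -
    obtain a b where "x = of_int a + of_int b * w" using x unfolding R by auto
    then have "x + of_int j = of_int (a + j) + of_int b * w" by simp
    then show ?thesis unfolding R by blast
  qed
  have PIdl_minus: "PIdl\<^bsub>?R\<^esub> (- x) = PIdl\<^bsub>?R\<^esub> x" for x
    unfolding cgenideal_ring_of_integers 
  proof (intro equalityI subsetI)
    fix z assume "z \<in> {y * (- x) |y. y \<in> carrier ?R}"
    then obtain y where "z = (- y) * x" "y \<in> carrier ?R" by auto
    then show "z \<in> {y * x |y. y \<in> carrier ?R}" using minus by blast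
  next
    fix z assume "z \<in> {y * x |y. y \<in> carrier ?R}"
    then obtain y where "z = (- y) * (- x)" "y \<in> carrier ?R" by auto
    then show "z \<in> {y * (- x) |y. y \<in> carrier ?R}" using minus by blast
  qed
  have f_minus: "- x \<in> ?f" if "x \<in> ?f" for x
  proof -
    obtain y where "- x = (- y) * of_nat f" "y \<in> carrier ?R"
      using \<open>x \<in> ?f\<close> unfolding cgenideal_ring_of_integers by auto
    then show ?thesis unfolding cgenideal_ring_of_integers using minus by blast
  qed
  have f_int: "x + of_int j \<in> ?f" if "x \<in> ?f" "int f dvd j" for x j
  proof -
    obtain y where y: "x = y * of_nat f" "y \<in> carrier ?R" 
      using \<open>x \<in> ?f\<close> unfolding cgenideal_ring_of_integers by auto
    obtain i where "j = int f * i" using \<open>int f dvd j\<close> by auto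
    then have "x + of_int j = (y + of_int i) * of_nat f" by (simp add: y algebra_simps)
    then show ?thesis unfolding cgenideal_ring_of_integers using plus_int[OF y(2)] by blast
  qed
  have "{PIdl\<^bsub>?R\<^esub> \<alpha> | \<alpha> (k :: int). \<alpha> \<in> carrier ?R \<and> \<alpha> \<noteq> 0 \<and> coprime k (int f) \<and> \<alpha> - of_int k \<in> ?f}
    = {PIdl\<^bsub>?R\<^esub> \<alpha> | \<alpha>. \<alpha> \<in> carrier ?R \<and> \<alpha> \<noteq> 0 \<and> \<alpha> - 1 \<in> ?f}" (is "?A = ?B")
  proof (intro equalityI subsetI)
    fix I assume "I \<in> ?A"
    then obtain \<alpha> k where \<alpha>: "I = PIdl\<^bsub>?R\<^esub> \<alpha>" "\<alpha> \<in> carrier ?R" "\<alpha> \<noteq> 0" "coprime k (int f)" 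
        "\<alpha> - of_int k \<in> ?f"
      by auto
    from f[OF \<alpha>(4)] show "I \<in> ?B"
    proof
      assume "[k = 1] (mod int f)"
      then have "int f dvd k - 1" by (simp add: cong_iff_dvd_diff)
      from f_int[OF \<alpha>(5) this] have "\<alpha> - 1 \<in> ?f" by (simp add: algebra_simps)
      with \<alpha> show ?thesis by blast
    next
      assume "[k = - 1] (mod int f)"
      then have "int f dvd k + 1" by (simp add: cong_iff_dvd_diff)
      \<comment> \<open>Here \<open>\<alpha> \<equiv> k \<equiv> -1\<close>, so
        \<open>- \<alpha>\<close> is the generator congruent to 1.\<close>
      moreover have "- \<alpha> - 1 = - (\<alpha> - of_int k + of_int (k + 1))" by simp
      ultimately have "- \<alpha> - 1 \<in> ?f" using f_minus f_int \<alpha>(5) by metis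
      moreover have "I = PIdl\<^bsub>?R\<^esub> (- \<alpha>)" "- \<alpha> \<noteq> 0" "- \<alpha> \<in> carrier ?R"
        using \<alpha> minus PIdl_minus by auto
      ultimately show ?thesis by blast
    qed
  next
    fix I assume "I \<in> ?B"
    then obtain \<alpha> where "I = PIdl\<^bsub>?R\<^esub> \<alpha>" "\<alpha> \<in> carrier ?R" "\<alpha> \<noteq> 0" "\<alpha> - 1 \<in> ?f" by auto
    moreover from this(4) have "\<alpha> - of_int 1 \<in> ?f" by simp
    moreover have "coprime 1 (int f)" by simp
    ultimately show "I \<in> ?A" by blast
  qed
  then show ?thesis by (simp only: ring_class_group_def ray_group_def)
qed

text \<open>Both sides are \<open>class_field\<close> of the same modulus and the same
  subgroup.\<close>

lemma ring_class_field_eq_ray_class_field: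
  assumes "carrier (ring_of_integers F) = {of_int a + of_int b * w |a b. True}"
    and "conductor F H = f"
    and "\<And>k. coprime k (int f) \<Longrightarrow> [k = 1] (mod int f) \<or> [k = - 1] (mod int f)"
  shows "ring_class_field F H = ray_class_field F (PIdl\<^bsub>ring_of_integers F\<^esub> (of_nat f))"
  using ring_class_group_eq_ray_group[OF assms(1,3)] assms(2)
  by (simp add: ring_class_field_def ray_class_field_def)

section \<open>Units modulo 3 and 6, the order \<int>[3s], and the two cases of the theorem\<close>

lemma coprime_3_cong:
  fixes k :: int
  assumes "coprime k 3"
  shows "[k = 1] (mod 3) \<or> [k = - 1] (mod 3)"
proof -
  have "\<not> 3 dvd k"
    using coprime_common_divisor[OF assms, of 3] by auto
  then show ?thesis unfolding cong_iff_dvd_diff by presburger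
qed

lemma coprime_6_cong:
  fixes k :: int
  assumes "coprime k 6"
  shows "[k = 1] (mod 6) \<or> [k = - 1] (mod 6)"
proof -
  have "coprime k (2 * 3)" using assms by simp
  then have "odd k" "coprime k 3" 
    unfolding coprime_mult_right_iff by (auto simp: coprime_right_2_iff_odd)
  then show ?thesis using coprime_3_cong[of k] unfolding cong_iff_dvd_diff by presburger
qed

text \<open>Common form of both cases: \<open>m = 3 * d\<close>, \<open>c = 1\<close> if 3 does not
  divide \<open>d\<close>, and \<open>m = d / 3\<close>, \<open>c = 3\<close> otherwise. The order
  \<int>[3s] has index 3 in \<int>[s], and \<int>[s] has index 2 in the maximal order exactly when
  \<open>m mod 4 = 3\<close>, so the conductor is 6 or 3.\<close>

lemma ring_class_field_order_3:
  fixes m c :: int and s :: complex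
  assumes m: "m > 0" "squarefree m" and s: "s = csqrt (of_int (- m))" and c: "c \<noteq> 0"
    and F: "F = generate_field CC {of_int c * s}" and H: "H = generate_ring CC {3 * s}"
  shows "m mod 4 = 3 \<Longrightarrow>
      ring_class_field F H = ray_class_field F (PIdl\<^bsub>ring_of_integers F\<^esub> (of_nat 6))"
    and "m mod 4 = 1 \<or> m mod 4 = 2 \<Longrightarrow>
      ring_class_field F H = ray_class_field F (PIdl\<^bsub>ring_of_integers F\<^esub> (of_nat 3))"
proof -
  have s': "s = \<i> * sqrt (of_int m)" using m s by simp
  have ss: "s * s = of_int (- m)" 
    using s power2_csqrt[of "of_int (- m)"] by (simp add: power2_eq_square)
  have Im: "Im s \<noteq> 0" using m s' by simp
  have cnj: "cnj s = - s" using s' by simp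
  have ratF: "s \<notin> \<rat>" using Im by (auto simp: Im_of_rat elim!: Rats_cases)
  have F': "F = {of_rat a + of_rat b * s |a b. True}"
    unfolding F by (rule generate_field_quadratic[OF ss ratF c])
  have "(3 * s) * (3 * s) = of_int (9 * (- m))" using ss by simp
  from generate_ring_quadratic[OF this]
  have H': "H = {of_int a + of_int b * (3 * s) |a b. True}" unfolding H .
  have ss': "s * s = - of_int m" using ss by simp
  {
    assume m4: "m mod 4 = 3"
    define w where "w = (1 + s) / 2"
    have w: "Im w \<noteq> 0" using Im by (simp add: w_def)
    have R: "carrier (ring_of_integers F) = {of_int a + of_int b * w |a b. True}"
      unfolding w_def by (rule ring_of_integers_quadratic_1[OF ss' cnj m(2) m4 F'])
    have s2: "s = 2 * w - 1" by (simp add: w_def)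
    \<comment> \<open>From \<open>3 * s = 6 * w - 3\<close>: passing to the basis \<open>1\<close>,
      \<open>w\<close> shifts the integer coordinate by \<open>3 * b\<close>.\<close>
    have w6: "of_int (a + 3 * b) + of_int b * (3 * s) = of_int a + of_int (int 6 * b) * w" for a b
      unfolding s2 by (simp add: algebra_simps)
    have "H = {of_int a + of_int (int 6 * b) * w |a b. True}"
    proof (intro equalityI subsetI)
      fix x assume "x \<in> H"
      then obtain a b where "x = of_int a + of_int b * (3 * s)" unfolding H' by auto
      then have "x = of_int (a - 3 * b) + of_int (int 6 * b) * w" using w6[of "a - 3 * b" b] by simp
      then show "x \<in> {of_int a + of_int (int 6 * b) * w |a b. True}" by blast
    next
      fix x assume "x \<in> {of_int a + of_int (int 6 * b) * w |a b. True}"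
      then show "x \<in> H" unfolding H' w6[symmetric] by blast
    qed
    from conductor_eqI[OF w _ R this] show 
      "ring_class_field F H = ray_class_field F (PIdl\<^bsub>ring_of_integers F\<^esub> (of_nat 6))"
      using coprime_6_cong by (intro ring_class_field_eq_ray_class_field[OF R]) auto
  }
  {
    assume m4: "m mod 4 = 1 \<or> m mod 4 = 2"
    have R: "carrier (ring_of_integers F) = {of_int a + of_int b * s |a b. True}"
      by (rule ring_of_integers_quadratic_2_3[OF ss' cnj m(2) m4 F'])
    have "H = {of_int a + of_int (int 3 * b) * s |a b. True}"
      unfolding H' by (simp add: mult_ac)
    from conductor_eqI[OF Im _ R this] show 
      "ring_class_field F H = ray_class_field F (PIdl\<^bsub>ring_of_integers F\<^esub> (of_nat 3))"
      using coprime_3_cong by (intro ring_class_field_eq_ray_class_field[OF R]) auto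
  }
qed

text \<open>Both principal roots lie on the positive imaginary axis, so no sign intervenes. It is
  applied to \<open>-27 * d = -9 * (3 * d)\<close> and, for \<open>d = 3 * m\<close>, to
  \<open>-3 * d = -9 * m\<close>.\<close>

lemma csqrt_neg_9_mult:
  assumes "m > 0"
  shows "csqrt (of_int (- (9 * m))) = 3 * csqrt (of_int (- m))"
proof -
  have "sqrt (9 * of_int m) = 3 * sqrt (of_int m)"
    by (simp add: real_sqrt_mult)
  then show ?thesis using assms by simp
qed

theorem theorem6p3:
  fixes d :: int and F M M3 :: "complex set" and ray :: "nat \<Rightarrow> complex set"
  assumes "d > 1" and "squarefree d"
    and "F = generate_field CC {csqrt (of_int (- 3 * d))}"
    and "M = ring_class_field F (generate_ring CC {csqrt (of_int (- 3 * d))})"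
    and "M3 = ring_class_field F (generate_ring CC {csqrt (of_int (- 27 * d))})"
    and "\<And>N. N > 0 \<Longrightarrow> ray N = ray_class_field F (PIdl\<^bsub>ring_of_integers F\<^esub> (of_nat N))"
  shows "(\<not> 3 dvd d \<longrightarrow>
            ([d = 1] (mod 4) \<longrightarrow> M3 = ray 6) \<and>
            ([d = 2] (mod 4) \<or> [d = 3] (mod 4) \<longrightarrow> M3 = ray 3)) \<and>
         (3 dvd d \<longrightarrow>
            ([d = 1] (mod 4) \<longrightarrow> M = ray 6) \<and>
            ([d = 2] (mod 4) \<or> [d = 3] (mod 4) \<longrightarrow> M = ray 3))"
proof (cases "3 dvd d")
  case False
  define s where "s = csqrt (of_int (- (3 * d)))"
  have "coprime 3 d"
    using False by (intro prime_imp_coprime) auto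
  then have sq: "squarefree (3 * d)"
    using assms(2) by (intro squarefree_mult_coprime squarefree_prime[of "3 :: int"]) simp_all
  have "csqrt (of_int (- 27 * d)) = 3 * s"
    using csqrt_neg_9_mult[of "3 * d"] assms(1) by (simp add: s_def)
  then have M3: "M3 = ring_class_field F (generate_ring CC {3 * s})"
    using assms(5) by simp
  have F: "F = generate_field CC {of_int 1 * s}" using assms(3) by (simp add: s_def)
  note 1 = ring_class_field_order_3[OF _ sq s_def _ F refl, folded M3]
  \<comment> \<open>Multiplication by 3 sends the residues 1, 2, 3 of \<open>d\<close> to 3, 2,
    1.\<close>
  have "(3 * d) mod 4 = 3 * (d mod 4) mod 4" by (simp add: mod_mult_right_eq)
  then have "[d = 1] (mod 4) \<Longrightarrow> (3 * d) mod 4 = 3"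
    and "[d = 2] (mod 4) \<or> [d = 3] (mod 4) \<Longrightarrow> (3 * d) mod 4 = 1 \<or> (3 * d) mod 4 = 2"
    by (auto simp: cong_def)
  with 1 False show ?thesis using assms(1,6) by auto
next
  case True
  then obtain m where d: "d = 3 * m" by auto
  \<comment> \<open>Now \<open>-3 * d = -9 * m\<close>, so the given root is \<open>3 * s\<close>:
    it generates the field with \<open>c = 3\<close>, and its order is already \<int>[3s]. Hence
    \<open>M\<close> takes the place of \<open>M3\<close>.\<close>
  define s where "s = csqrt (of_int (- m))"
  have m: "m > 0" "squarefree m" 
    using assms(1,2) squarefree_mono[of m d] by (auto simp: d)
  have s3: "csqrt (of_int (- 3 * d)) = 3 * s"
    using csqrt_neg_9_mult[of m] m by (simp add: s_def d)
  have M: "M = ring_class_field F (generate_ring CC {3 * s})"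
    using assms(4) s3 by simp
  have F: "F = generate_field CC {of_int 3 * s}" using assms(3) s3 by simp
  note 1 = ring_class_field_order_3[OF m s_def _ F refl, folded M]
  \<comment> \<open>Since 9 is 1 modulo 4, \<open>m\<close> has the residue of \<open>3 * d\<close>,
    as in the other case.\<close>
  have "3 * d = m + 4 * (2 * m)" by (simp add: d)
  then have "m mod 4 = (3 * d) mod 4" by (simp only: mod_mult_self2)
  also have "\<dots> = 3 * (d mod 4) mod 4" by (simp add: mod_mult_right_eq)
  finally have "[d = 1] (mod 4) \<Longrightarrow> m mod 4 = 3"
    and "[d = 2] (mod 4) \<or> [d = 3] (mod 4) \<Longrightarrow> m mod 4 = 1 \<or> m mod 4 = 2"
    by (auto simp: cong_def)
  with 1 True show ?thesis using assms(6) by auto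
qed

end
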